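(* Let $\lambda_1,\lambda_2,\lambda_3\in\mathbb{R}$ with $\lambda_1\lambda_2\neq 0$ and $\lambda_3\neq 0$, and let $\mathbb{K}_{\lambda_1,\lambda_2,\lambda_3}$ be the 3-parameter generalized quaternion algebra over $\mathbb{R}$. Then every local derivation of $\mathbb{K}_{\lambda_1,\lambda_2,\lambda_3}$ is a derivation.
   Context: For $\lambda_1,\lambda_2,\lambda_3\in\mathbb{R}$, the 3-parameter generalized quaternion algebra $\mathbb{K}_{\lambda_1,\lambda_2,\lambda_3}$ is the 4-dimensional real algebra with basis $e_0,e_1,e_2,e_3$, where $e_0=1$ is the identity and the multiplication is given by $e_1^2=-\lambda_1\lambda_2$, $e_2^2=-\lambda_1\lambda_3$, $e_3^2=-\lambda_2\lambda_3$, $e_1e_2=\lambda_1e_3=-e_2e_1$, $e_2e_3=\lambda_3e_1=-e_3e_2$, $e_3e_1=\lambda_2e_2=-e_1e_3$. A derivation of an algebra $\mathcal{A}$ is a linear map $D:\mathcal{A}\to\mathcal{A}$ with $D(xy)=D(x)y+xD(y)$ for all $x,y\in\mathcal{A}$. A local derivation of $\mathcal{A}$ is a linear map $\Delta:\mathcal{A}\to\mathcal{A}$ such that for every $x\in\mathcal{A}$ there exists a derivation $D_x$ of $\mathcal{A}$ with $\Delta(x)=D_x(x)$. *)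

theory Defs
  imports "HOL-Analysis.Analysis"
begin

(* An algebra here is a real vector space together with a multiplication m;
   the multiplication is an explicit argument because that of the generalized
   quaternions depends on three real parameters. *)

definition derivation :: "('a::real_vector \<Rightarrow> 'a \<Rightarrow> 'a) \<Rightarrow> ('a \<Rightarrow> 'a) \<Rightarrow> bool" where
  "derivation m D \<longleftrightarrow> linear D \<and> (\<forall>x y. D (m x y) = m (D x) y + m x (D y))"

definition local_derivation :: "('a::real_vector \<Rightarrow> 'a \<Rightarrow> 'a) \<Rightarrow> ('a \<Rightarrow> 'a) \<Rightarrow> bool" where
  "local_derivation m \<Delta> \<longleftrightarrow> linear \<Delta> \<and> (\<forall>x. \<exists>D. derivation m D \<and> \<Delta> x = D x)"

(* The underlying space is real^4 with coordinates indexed by 0, 1, 2, 3 :: 4.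
   In this index type 4 = 0, so library rules phrased with the indices 1, 2, 3, 4
   have coordinate 0 in last place. *)

definition gq_basis :: "4 \<Rightarrow> real ^ 4" where
  "gq_basis i = axis i 1"

(* The bilinear extension of the multiplication table on e_0, ..., e_3, written in
   coordinates; gq_mult_table and bilinear_gq_mult below determine it uniquely. *)

definition gq_mult :: "real \<Rightarrow> real \<Rightarrow> real \<Rightarrow> real ^ 4 \<Rightarrow> real ^ 4 \<Rightarrow> real ^ 4" where
  "gq_mult l1 l2 l3 x y = (\<chi> i.
     if i = 0 then x$0 * y$0 - l1 * l2 * (x$1 * y$1) - l1 * l3 * (x$2 * y$2) - l2 * l3 * (x$3 * y$3)
     else if i = 1 then x$0 * y$1 + x$1 * y$0 + l3 * (x$2 * y$3 - x$3 * y$2)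
     else if i = 2 then x$0 * y$2 + x$2 * y$0 + l2 * (x$3 * y$1 - x$1 * y$3)
     else x$0 * y$3 + x$3 * y$0 + l1 * (x$1 * y$2 - x$2 * y$1))"

lemma four_eq_zero: "(4::4) = 0"
  by simp

lemma vec4_eq_iff: "(x::real ^ 4) = y \<longleftrightarrow> x$0 = y$0 \<and> x$1 = y$1 \<and> x$2 = y$2 \<and> x$3 = y$3"
  unfolding vec_eq_iff forall_4 four_eq_zero by auto

lemma gq_mult_nth:
  "gq_mult l1 l2 l3 x y $ 0 =
     x$0 * y$0 - l1 * l2 * (x$1 * y$1) - l1 * l3 * (x$2 * y$2) - l2 * l3 * (x$3 * y$3)"
  "gq_mult l1 l2 l3 x y $ 1 = x$0 * y$1 + x$1 * y$0 + l3 * (x$2 * y$3 - x$3 * y$2)"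
  "gq_mult l1 l2 l3 x y $ 2 = x$0 * y$2 + x$2 * y$0 + l2 * (x$3 * y$1 - x$1 * y$3)"
  "gq_mult l1 l2 l3 x y $ 3 = x$0 * y$3 + x$3 * y$0 + l1 * (x$1 * y$2 - x$2 * y$1)"
  by (simp_all add: gq_mult_def)

lemma bilinear_gq_mult: "bilinear (gq_mult l1 l2 l3)"
  unfolding bilinear_def
  by (auto intro!: linearI simp: vec4_eq_iff gq_mult_nth algebra_simps)

lemma gq_basis_nth: "gq_basis i $ j = (if i = j then 1 else 0)"
  by (auto simp: gq_basis_def axis_def)

lemma gq_mult_table:
  "gq_mult l1 l2 l3 (gq_basis 0) x = x"
  "gq_mult l1 l2 l3 x (gq_basis 0) = x"
  "gq_mult l1 l2 l3 (gq_basis 1) (gq_basis 1) = (- (l1 * l2)) *\<^sub>R gq_basis 0"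
  "gq_mult l1 l2 l3 (gq_basis 2) (gq_basis 2) = (- (l1 * l3)) *\<^sub>R gq_basis 0"
  "gq_mult l1 l2 l3 (gq_basis 3) (gq_basis 3) = (- (l2 * l3)) *\<^sub>R gq_basis 0"
  "gq_mult l1 l2 l3 (gq_basis 1) (gq_basis 2) = l1 *\<^sub>R gq_basis 3"
  "gq_mult l1 l2 l3 (gq_basis 2) (gq_basis 1) = - (l1 *\<^sub>R gq_basis 3)"
  "gq_mult l1 l2 l3 (gq_basis 2) (gq_basis 3) = l3 *\<^sub>R gq_basis 1"
  "gq_mult l1 l2 l3 (gq_basis 3) (gq_basis 2) = - (l3 *\<^sub>R gq_basis 1)"
  "gq_mult l1 l2 l3 (gq_basis 3) (gq_basis 1) = l2 *\<^sub>R gq_basis 2"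
  "gq_mult l1 l2 l3 (gq_basis 1) (gq_basis 3) = - (l2 *\<^sub>R gq_basis 2)"
  by (simp_all add: vec4_eq_iff gq_mult_nth gq_basis_nth)

end

theory Submission
  imports Defs
begin

(* For purely imaginary x the square x x is a scalar, so D x anticommutes with x for every
   derivation D: hence D x is orthogonal to x for the norm form and has no scalar part.  Both
   properties constrain D only at a single point, so a local derivation inherits them; by
   polarization it is skew for the norm form on the imaginary part.  As that form is
   nondegenerate in dimension three, the skew maps are exactly the (weighted) cross products
   with a fixed vector, and these are derivations. *)

text \<open>The polar form of the quaternion norm \<open>x * conj x\<close>, restricted to imaginary
  parts: coordinate 0 is left out on purpose.\<close>

definition gq_norm_form :: "real \<Rightarrow> real \<Rightarrow> real \<Rightarrow> real ^ 4 \<Rightarrow> real ^ 4 \<Rightarrow> real" where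
  "gq_norm_form l1 l2 l3 x y = l1 * l2 * (x$1 * y$1) + l1 * l3 * (x$2 * y$2) + l2 * l3 * (x$3 * y$3)"

lemma gq_basis_expansion:
  "x = x$0 *\<^sub>R gq_basis 0 + x$1 *\<^sub>R gq_basis 1 + x$2 *\<^sub>R gq_basis 2 + x$3 *\<^sub>R gq_basis 3"
  by (simp add: vec4_eq_iff gq_basis_nth)

lemma linear_gq_basis_expansion:
  assumes "linear D"
  shows "D x = x$0 *\<^sub>R D (gq_basis 0) + x$1 *\<^sub>R D (gq_basis 1) + x$2 *\<^sub>R D (gq_basis 2)
    + x$3 *\<^sub>R D (gq_basis 3)"
  by (subst gq_basis_expansion[of x]) (simp only: linear_add[OF assms] linear_scale[OF assms])

lemma derivation_gq_basis_0:
  assumes "derivation (gq_mult l1 l2 l3) D"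
  shows "D (gq_basis 0) = 0"
proof -
  have "D (gq_mult l1 l2 l3 (gq_basis 0) (gq_basis 0)) = D (gq_basis 0) + D (gq_basis 0)"
    using assms unfolding derivation_def by (metis gq_mult_table(1,2))
  then show ?thesis
    by (simp add: gq_mult_table(1))
qed

text \<open>In \<open>D x * x + x * D x = 0\<close> the cross product terms cancel. Coordinate 0 is
  then -2 times the norm form, and each imaginary coordinate is twice a product
  \<open>D x $ 0 * x $ i\<close>.\<close>

lemma derivation_imaginary:
  assumes D: "derivation (gq_mult l1 l2 l3) D" and x: "x$0 = 0"
  shows "gq_norm_form l1 l2 l3 (D x) x = 0"
    and "D x $ 0 * x $ i = 0"
proof -
  have lin: "linear D"
    using D by (simp add: derivation_def)
  have "gq_mult l1 l2 l3 x x = (- gq_norm_form l1 l2 l3 x x) *\<^sub>R gq_basis 0"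
    using x by (simp add: vec4_eq_iff gq_mult_nth gq_basis_nth gq_norm_form_def)
  then have "D (gq_mult l1 l2 l3 x x) = 0"
    by (simp add: linear_neg[OF lin] linear_scale[OF lin] derivation_gq_basis_0[OF D])
  then have *: "gq_mult l1 l2 l3 (D x) x + gq_mult l1 l2 l3 x (D x) = 0"
    using D by (simp add: derivation_def)
  show "gq_norm_form l1 l2 l3 (D x) x = 0"
    using * x by (simp add: vec4_eq_iff gq_mult_nth gq_norm_form_def algebra_simps)
  have "D x $ 0 * x $ 0 = 0 \<and> D x $ 0 * x $ 1 = 0 \<and> D x $ 0 * x $ 2 = 0 \<and> D x $ 0 * x $ 3 = 0"
    using * x by (simp add: vec4_eq_iff gq_mult_nth algebra_simps)
  then have "\<forall>i. D x $ 0 * x $ i = 0"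
    unfolding forall_4 four_eq_zero by blast
  then show "D x $ 0 * x $ i = 0" ..
qed

text \<open>Such a \<open>D\<close> is inner: it is \<open>x \<mapsto> (v * x - x * v) / 2\<close>
  for the imaginary \<open>v\<close> with coordinates \<open>r\<close>, \<open>q\<close>,
  \<open>p\<close>.\<close>

lemma derivation_cross:
  assumes lin: "linear D"
    and "\<And>x. D x $ 0 = 0"
    and "\<And>x. D x $ 1 = l3 * (q * x$3 - p * x$2)"
    and "\<And>x. D x $ 2 = l2 * (p * x$1 - r * x$3)"
    and "\<And>x. D x $ 3 = l1 * (r * x$2 - q * x$1)"
  shows "derivation (gq_mult l1 l2 l3) D"
  unfolding derivation_def
  using lin by (simp add: vec4_eq_iff gq_mult_nth assms(2-)) (simp add: algebra_simps)

theorem theorem2p2: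
  fixes l1 l2 l3 :: real and \<Delta> :: "real ^ 4 \<Rightarrow> real ^ 4"
  assumes "l1 * l2 \<noteq> 0" and "l3 \<noteq> 0"
    and "local_derivation (gq_mult l1 l2 l3) \<Delta>"
  shows "derivation (gq_mult l1 l2 l3) \<Delta>"
proof -
  have nz: "l1 \<noteq> 0" "l2 \<noteq> 0" "l3 \<noteq> 0"
    using assms(1,2) by auto
  have lin: "linear \<Delta>" and loc: "\<And>x. \<exists>D. derivation (gq_mult l1 l2 l3) D \<and> \<Delta> x = D x"
    using assms(3) by (auto simp: local_derivation_def)
  have im: "\<Delta> x $ 0 * x $ i = 0" and skew: "gq_norm_form l1 l2 l3 (\<Delta> x) x = 0"
    if "x$0 = 0" for x i
    using loc[of x] derivation_imaginary that by metis+
  define a where "a i j = \<Delta> (gq_basis j) $ i" for i j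
  have e0: "\<Delta> (gq_basis 0) = 0"
    using loc[of "gq_basis 0"] derivation_gq_basis_0 by metis
  have nth: "\<Delta> x $ i = x$1 * a i 1 + x$2 * a i 2 + x$3 * a i 3" for x i
    by (subst linear_gq_basis_expansion[OF lin]) (simp add: a_def e0)
  have a0: "a 0 1 = 0" "a 0 2 = 0" "a 0 3 = 0"
    using im[of "gq_basis 1" 1] im[of "gq_basis 2" 2] im[of "gq_basis 3" 3]
    by (simp_all add: gq_basis_nth a_def)
  have diag: "a 1 1 = 0" "a 2 2 = 0" "a 3 3 = 0"
    using skew[of "gq_basis 1"] skew[of "gq_basis 2"] skew[of "gq_basis 3"] nz
    by (simp_all add: gq_basis_nth a_def gq_norm_form_def)
  \<comment> \<open>Polarization: as the diagonal entries vanish, evaluating the form at a sum of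
    two basis vectors leaves only the two mixed entries.\<close>
  have "l1 * (l2 * a 1 2 + l3 * a 2 1) = 0"
    using skew[of "gq_basis 1 + gq_basis 2"]
    by (simp add: gq_basis_nth gq_norm_form_def nth diag algebra_simps)
  \<comment> \<open>Solved so that the entry becomes \<open>- l3 * p\<close>, with
    \<open>p = a 2 1 / l2\<close> the parameter of the final cross product; \<open>q\<close> and
    \<open>r\<close> arise likewise below.\<close>
  then have a12: "a 1 2 = - (l3 * (a 2 1 / l2))"
    using nz by (simp add: field_simps) algebra
  have "l2 * (l1 * a 1 3 + l3 * a 3 1) = 0"
    using skew[of "gq_basis 1 + gq_basis 3"]
    by (simp add: gq_basis_nth gq_norm_form_def nth diag algebra_simps)
  then have a31: "a 3 1 = - (l1 * (a 1 3 / l3))"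
    using nz by (simp add: field_simps) algebra
  have "l3 * (l1 * a 2 3 + l2 * a 3 2) = 0"
    using skew[of "gq_basis 2 + gq_basis 3"]
    by (simp add: gq_basis_nth gq_norm_form_def nth diag algebra_simps)
  then have a23: "a 2 3 = - (l2 * (a 3 2 / l1))"
    using nz by (simp add: field_simps) algebra
  show ?thesis
  \<comment> \<open>The witnesses are read off from \<open>a 2 1 = l2 * p\<close>,
    \<open>a 1 3 = l3 * q\<close> and \<open>a 3 2 = l1 * r\<close>; skewness fixes the other three
    off-diagonal imaginary entries.\<close>
  proof (rule derivation_cross[OF lin, where p = "a 2 1 / l2" and q = "a 1 3 / l3" and r = "a 3 2 / l1"])
    fix x
    show "\<Delta> x $ 0 = 0"
      by (simp add: nth a0)
    show "\<Delta> x $ 1 = l3 * (a 1 3 / l3 * x$3 - a 2 1 / l2 * x$2)"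
      using nz by (simp add: nth diag a12 algebra_simps)
    show "\<Delta> x $ 2 = l2 * (a 2 1 / l2 * x$1 - a 3 2 / l1 * x$3)"
      using nz by (simp add: nth diag a23 algebra_simps)
    show "\<Delta> x $ 3 = l1 * (a 3 2 / l1 * x$2 - a 1 3 / l3 * x$1)"
      using nz by (simp add: nth diag a31 algebra_simps)
  qed
qed

end
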